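(* Let $x>1$ and let $f,g,h$ be positive and continuous functions on $[1,\infty)$ such that $$(g(\tau)-g(\sigma))\left(\frac{f(\sigma)}{h(\sigma)}-\frac{f(\tau)}{h(\tau)}\right)\ge 0\quad\text{for all }\tau,\sigma\in[1,x).$$ Then for all $\alpha>0$ and $\beta\in(0,1]$, $$\frac{\mathcal{H}^{\alpha,\beta}_{1,x}[f(x)]}{\mathcal{H}^{\alpha,\beta}_{1,x}[h(x)]}\ge\frac{\mathcal{H}^{\alpha,\beta}_{1,x}[(gf)(x)]}{\mathcal{H}^{\alpha,\beta}_{1,x}[(gh)(x)]}.$$
   Context: For $\alpha>0$, $\beta\in(0,1]$ and $x>1$, the one-sided generalized proportional Hadamard fractional integral of a function $z$ on $[1,\infty)$ is $$\mathcal{H}^{\alpha,\beta}_{1,x}[z(x)]=(\mathcal{H}^{\alpha,\beta}_{1,x}z)(x)=\frac{1}{\beta^{\alpha}\Gamma(\alpha)}\int_{1}^{x}e^{\frac{\beta-1}{\beta}(\ln x-\ln t)}(\ln x-\ln t)^{\alpha-1}\frac{z(t)}{t}\,dt,$$ where $\Gamma$ is the gamma function. Here $(gf)(x)=g(x)f(x)$ is the pointwise product. *)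

theory Defs
  imports "HOL-Analysis.Analysis"
begin

text \<open>
  One-sided generalized proportional Hadamard fractional integral with lower limit 1,
  meant for \<open>\<alpha> > 0\<close>, \<open>\<beta> \<in> (0,1]\<close> and \<open>x > 1\<close>.  For \<open>\<alpha> < 1\<close> the kernel is singular at
  \<open>t = x\<close>, where \<open>0 powr (\<alpha> - 1) = 0\<close> by convention; this single point is a null set, and
  for \<open>z\<close> continuous on \<open>[1,x]\<close> the Lebesgue integral converges absolutely.
\<close>

definition prop_hadamard :: "real \<Rightarrow> real \<Rightarrow> (real \<Rightarrow> real) \<Rightarrow> real \<Rightarrow> real" where
  "prop_hadamard \<alpha> \<beta> z x =
     1 / (\<beta> powr \<alpha> * Gamma \<alpha>) *
     (LINT t:{1..x}|lborel.
        exp ((\<beta> - 1) / \<beta> * (ln x - ln t)) * (ln x - ln t) powr (\<alpha> - 1) * (z t / t))"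

end

theory Submission
  imports Defs
begin

text \<open>
  The claim is Chebyshev's integral inequality for two oppositely ordered functions.
  Let \<open>w\<close> be the kernel of the integral operator.  Multiplying the hypothesis by
  \<open>h \<sigma> * h \<tau>\<close> and by the weights \<open>w \<sigma> * w \<tau>\<close> removes the quotients:
  with \<open>a = w f\<close> and \<open>b = w h\<close> it becomes
  \<open>(g \<tau> - g \<sigma>) * (a \<sigma> * b \<tau> - a \<tau> * b \<sigma>) \<ge> 0\<close>.
  Integrating this over \<open>\<tau>\<close> and then over \<open>\<sigma>\<close> gives, by symmetry, twice
  \<open>(\<integral>a) (\<integral>g b) - (\<integral>g a) (\<integral>b) \<ge> 0\<close>
  (lemma \<open>chebyshev_integral_cross_mult\<close>), and dividing by the positive
  numbers \<open>\<integral>b\<close> and \<open>\<integral>g b\<close> is the theorem.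

  The analytic input is that these integrals converge, although the kernel is unbounded
  near \<open>x\<close> when \<open>\<alpha> < 1\<close>, and that they are positive.  For convergence,
  \<open>(ln x - ln t) powr (\<alpha> - 1) / t\<close> has the antiderivative
  \<open>- (ln x - ln t) powr \<alpha> / \<alpha>\<close>, which is continuous up to \<open>x\<close> because
  \<open>\<alpha> > 0\<close>; the remaining factors are bounded.
\<close>

text \<open>
  The expanded product is a sum of terms \<open>u s * v t\<close>, so the double integral reduces to
  two successive one-variable integrations by linearity alone, for any measure \<open>M\<close>.
\<close>

lemma chebyshev_integral_cross_mult:
  fixes a b g :: "'a \<Rightarrow> real"
  assumes int: "integrable M a" "integrable M b"
      "integrable M (\<lambda>t. g t * a t)" "integrable M (\<lambda>t. g t * b t)"
    and nonneg: "\<And>s t. (g t - g s) * (a s * b t - a t * b s) \<ge> 0"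
  shows "(\<integral>t. g t * a t \<partial>M) * (\<integral>t. b t \<partial>M) \<le> (\<integral>t. a t \<partial>M) * (\<integral>t. g t * b t \<partial>M)"
proof -
  define A where "A = (\<integral>t. a t \<partial>M)"
  define B where "B = (\<integral>t. b t \<partial>M)"
  define GA where "GA = (\<integral>t. g t * a t \<partial>M)"
  define GB where "GB = (\<integral>t. g t * b t \<partial>M)"
  have inner: "0 \<le> a s * GB - b s * GA - (g s * a s) * B + (g s * b s) * A" for s
  proof -
    have "0 \<le> (\<integral>t. (g t - g s) * (a s * b t - a t * b s) \<partial>M)"
      using nonneg by (intro integral_nonneg_AE) auto
    also have "\<dots> = (\<integral>t. a s * (g t * b t) - b s * (g t * a t)
        - (g s * a s) * b t + (g s * b s) * a t \<partial>M)"
      by (intro Bochner_Integration.integral_cong refl) (simp add: algebra_simps)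
    also have "\<dots> = a s * GB - b s * GA - (g s * a s) * B + (g s * b s) * A"
      using int by (simp add: A_def B_def GA_def GB_def)
    finally show ?thesis .
  qed
  have "0 \<le> (\<integral>s. a s * GB - b s * GA - (g s * a s) * B + (g s * b s) * A \<partial>M)"
    using inner by (intro integral_nonneg_AE) auto
  also have "\<dots> = A * GB - B * GA - GA * B + GB * A"
    using int by (simp add: A_def B_def GA_def GB_def)
  finally show ?thesis
    unfolding A_def[symmetric] B_def[symmetric] GA_def[symmetric] GB_def[symmetric]
    by (simp add: algebra_simps)
qed

text \<open>
  The interval starts at an arbitrary \<open>a > 0\<close> so that starting strictly to the left of
  \<open>1\<close> covers the half-open interval from \<open>1\<close> to \<open>x\<close>.
\<close>

lemma hadamard_kernel_set_integrable:
  fixes a x \<alpha> :: real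
  assumes "0 < a" "a < x" "\<alpha> > 0"
  shows "set_integrable lborel {a<..<x} (\<lambda>t. (ln x - ln t) powr (\<alpha> - 1) / t)"
proof -
  let ?F = "\<lambda>t. - ((ln x - ln t) powr \<alpha> / \<alpha>)"
  have "set_integrable lborel (einterval (ereal a) (ereal x))
          (\<lambda>t. (ln x - ln t) powr (\<alpha> - 1) / t)"
  proof (rule interval_integral_FTC_nonneg(1))
    show "ereal a < ereal x" using assms by simp
    show "DERIV ?F t :> (ln x - ln t) powr (\<alpha> - 1) / t"
      if "ereal a < ereal t" "ereal t < ereal x" for t
    proof -
      have "0 < t" "ln t < ln x" using that assms by auto
      then show ?thesis using assms
        by (auto intro!: derivative_eq_intros simp: field_simps powr_diff)
    qed
    show "isCont (\<lambda>t. (ln x - ln t) powr (\<alpha> - 1) / t) t"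
      if "ereal a < ereal t" "ereal t < ereal x" for t
      using that assms by (auto intro!: continuous_intros)
    show "AE t in lborel. ereal a < ereal t \<longrightarrow> ereal t < ereal x \<longrightarrow>
            0 \<le> (ln x - ln t) powr (\<alpha> - 1) / t"
      using assms by auto
    have "(?F \<longlongrightarrow> ?F a) (at_right a)"
      using assms by (intro tendsto_intros) auto
    then show "((?F \<circ> real_of_ereal) \<longlongrightarrow> ?F a) (at_right (ereal a))"
      by (simp add: ereal_tendsto_simps)
    have "eventually (\<lambda>t. 0 \<le> ln x - ln t) (at_left x)"
      using eventually_at_left_real[OF assms(2)] by eventually_elim (use assms in auto)
    then have "(?F \<longlongrightarrow> ?F x) (at_left x)"
      using assms by (intro tendsto_minus tendsto_divide tendsto_powr' tendsto_diff tendsto_ln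
          tendsto_const tendsto_ident_at) auto
    then show "((?F \<circ> real_of_ereal) \<longlongrightarrow> ?F x) (at_left (ereal x))"
      by (simp add: ereal_tendsto_simps)
  qed
  then show ?thesis by simp
qed

definition hadamard_weight :: "real \<Rightarrow> real \<Rightarrow> real \<Rightarrow> real \<Rightarrow> real" where
  "hadamard_weight \<alpha> \<beta> x t = indicator {1..x} t *
     (exp ((\<beta> - 1) / \<beta> * (ln x - ln t)) * (ln x - ln t) powr (\<alpha> - 1) / t)"

lemma prop_hadamard_eq_weighted_integral:
  "prop_hadamard \<alpha> \<beta> z x =
     1 / (\<beta> powr \<alpha> * Gamma \<alpha>) * (\<integral>t. hadamard_weight \<alpha> \<beta> x t * z t \<partial>lborel)"
  unfolding prop_hadamard_def hadamard_weight_def set_lebesgue_integral_def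
  by (simp add: mult.assoc)

lemma hadamard_weight_nonneg: "0 \<le> hadamard_weight \<alpha> \<beta> x t"
  by (simp add: hadamard_weight_def indicator_def)

text \<open>
  At \<open>t = x\<close> the weight is \<open>0\<close>, by \<open>0 powr (\<alpha> - 1) = 0\<close>; hence pointwise statements about
  the weighted functions need information on \<open>{1..<x}\<close> only.
\<close>

lemma hadamard_weight_eq_0: "t \<notin> {1..<x} \<Longrightarrow> hadamard_weight \<alpha> \<beta> x t = 0"
  by (cases "t = x") (auto simp: hadamard_weight_def indicator_def)

lemma hadamard_weight_pos: "t \<in> {1..<x} \<Longrightarrow> 0 < hadamard_weight \<alpha> \<beta> x t"
  by (simp add: hadamard_weight_def)

text \<open>
  The singular factor is integrable, and the exponential together with \<open>z\<close> is continuous on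
  the compact interval \<open>{1..x}\<close>, hence bounded there.
\<close>

lemma hadamard_weight_integrable:
  assumes "x > 1" "\<alpha> > 0" and z: "continuous_on {1..x} z"
  shows "integrable lborel (\<lambda>t. hadamard_weight \<alpha> \<beta> x t * z t)"
proof -
  define k where "k t = indicator {1..<x} t *\<^sub>R ((ln x - ln t) powr (\<alpha> - 1) / t)" for t
  define u where "u t = exp ((\<beta> - 1) / \<beta> * (ln x - ln t)) * z t" for t
  have "set_integrable lborel {1..<x} (\<lambda>t. (ln x - ln t) powr (\<alpha> - 1) / t)"
    by (rule set_integrable_subset[OF hadamard_kernel_set_integrable[of "1/2" x \<alpha>]])
       (use assms in auto)
  then have k: "integrable lborel k"
    unfolding k_def[abs_def] set_integrable_def .
  have cont: "continuous_on {1..x} u"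
    unfolding u_def by (intro continuous_intros z) auto
  then obtain C where C: "\<And>t. t \<in> {1..x} \<Longrightarrow> norm (u t) \<le> C"
    using compact_continuous_image[OF cont] compact_imp_bounded bounded_iff
    by (metis compact_Icc imageI)
  have [measurable]: "(\<lambda>t. indicator {1..x} t *\<^sub>R u t) \<in> borel_measurable borel"
    by (intro borel_measurable_continuous_on_indicator cont) auto
  have [measurable]: "k \<in> borel_measurable borel"
    using borel_measurable_integrable[OF k] by simp
  have eq: "hadamard_weight \<alpha> \<beta> x t * z t = k t * (indicator {1..x} t *\<^sub>R u t)" for t
    by (cases "t = x") (auto simp: hadamard_weight_def k_def u_def indicator_def)
  have "integrable lborel (\<lambda>t. k t * (indicator {1..x} t *\<^sub>R u t))"
  proof (rule Bochner_Integration.integrable_bound)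
    show "integrable lborel (\<lambda>t. C * k t)" using k by simp
    show "AE t in lborel. norm (k t * (indicator {1..x} t *\<^sub>R u t)) \<le> norm (C * k t)"
    proof (rule AE_I2)
      fix t
      have "norm (indicator {1..x} t *\<^sub>R u t) \<le> \<bar>C\<bar>"
        using C[of t] by (auto simp: indicator_def)
      then show "norm (k t * (indicator {1..x} t *\<^sub>R u t)) \<le> norm (C * k t)"
        unfolding norm_mult mult.commute[of "norm C"] by (intro mult_left_mono) auto
    qed
  qed measurable
  then show ?thesis by (simp only: eq)
qed

lemma hadamard_weight_integral_pos:
  assumes "x > 1" "\<alpha> > 0" "continuous_on {1..x} z" and pos: "\<And>t. t \<in> {1..x} \<Longrightarrow> 0 < z t"
  shows "0 < (\<integral>t. hadamard_weight \<alpha> \<beta> x t * z t \<partial>lborel)"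
proof -
  let ?u = "\<lambda>t. hadamard_weight \<alpha> \<beta> x t * z t"
  have int: "integrable lborel ?u"
    using assms by (intro hadamard_weight_integrable)
  have nonneg: "0 \<le> ?u t" for t
    using hadamard_weight_nonneg[of \<alpha> \<beta> x t] hadamard_weight_eq_0[of t x \<alpha> \<beta>] pos[of t]
    by (cases "t \<in> {1..<x}") (auto intro!: mult_nonneg_nonneg)
  have "integral\<^sup>L lborel ?u \<noteq> 0"
  proof
    assume "integral\<^sup>L lborel ?u = 0"
    then have "AE t in lborel. ?u t = 0"
      using integral_nonneg_eq_0_iff_AE[OF int] nonneg by auto
    moreover have "?u t \<noteq> 0" if "t \<in> {1..<x}" for t
      using hadamard_weight_pos[OF that, of \<alpha> \<beta>] pos[of t] that by auto
    ultimately have "AE t in lborel. t \<notin> {1..<x}"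
      by (auto elim!: eventually_mono)
    then have "emeasure lborel {1..<x} = 0"
      by (subst (asm) AE_iff_measurable[of "{1..<x}"]) auto
    with \<open>x > 1\<close> show False by simp
  qed
  moreover have "0 \<le> integral\<^sup>L lborel ?u"
    using nonneg by (intro integral_nonneg_AE) auto
  ultimately show ?thesis by simp
qed

theorem theorem4p5:
  fixes f g h :: "real \<Rightarrow> real" and x \<alpha> \<beta> :: real
  assumes "x > 1"
    and "continuous_on {1..} f" "continuous_on {1..} g" "continuous_on {1..} h"
    and "\<forall>t\<ge>1. f t > 0" "\<forall>t\<ge>1. g t > 0" "\<forall>t\<ge>1. h t > 0"
    and "\<forall>\<tau>\<in>{1..<x}. \<forall>\<sigma>\<in>{1..<x}. (g \<tau> - g \<sigma>) * (f \<sigma> / h \<sigma> - f \<tau> / h \<tau>) \<ge> 0"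
    and "\<alpha> > 0" and "0 < \<beta>" "\<beta> \<le> 1"
  shows "prop_hadamard \<alpha> \<beta> f x / prop_hadamard \<alpha> \<beta> h x
       \<ge> prop_hadamard \<alpha> \<beta> (\<lambda>t. g t * f t) x / prop_hadamard \<alpha> \<beta> (\<lambda>t. g t * h t) x"
proof -
  define w where "w = hadamard_weight \<alpha> \<beta> x"
  define c where "c = 1 / (\<beta> powr \<alpha> * Gamma \<alpha>)"
  have "c > 0"
    using assms by (simp add: c_def Gamma_real_pos)
  have cont: "continuous_on {1..x} f" "continuous_on {1..x} g" "continuous_on {1..x} h"
    using assms by (auto elim!: continuous_on_subset)
  have cross: "(g \<tau> - g \<sigma>) * ((w \<sigma> * f \<sigma>) * (w \<tau> * h \<tau>) - (w \<tau> * f \<tau>) * (w \<sigma> * h \<sigma>)) \<ge> 0" for \<sigma> \<tau>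
  proof (cases "\<sigma> \<in> {1..<x} \<and> \<tau> \<in> {1..<x}")
    case True
    then have h: "h \<sigma> > 0" "h \<tau> > 0" using assms by auto
    have "0 \<le> (w \<sigma> * w \<tau> * h \<sigma> * h \<tau>) * ((g \<tau> - g \<sigma>) * (f \<sigma> / h \<sigma> - f \<tau> / h \<tau>))"
    proof (rule mult_nonneg_nonneg)
      show "0 \<le> w \<sigma> * w \<tau> * h \<sigma> * h \<tau>"
        using h by (simp add: w_def hadamard_weight_nonneg)
      show "0 \<le> (g \<tau> - g \<sigma>) * (f \<sigma> / h \<sigma> - f \<tau> / h \<tau>)"
        using True assms(8) by blast
    qed
    also have "\<dots> = (g \<tau> - g \<sigma>) * ((w \<sigma> * f \<sigma>) * (w \<tau> * h \<tau>) - (w \<tau> * f \<tau>) * (w \<sigma> * h \<sigma>))"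
      using h by (simp add: field_simps)
    finally show ?thesis .
  next
    case False
    then have "w \<sigma> = 0 \<or> w \<tau> = 0"
      using hadamard_weight_eq_0[of _ x \<alpha> \<beta>] by (auto simp: w_def)
    then show ?thesis by auto
  qed
  have int: "integrable lborel (\<lambda>t. w t * z t)" if "continuous_on {1..x} z" for z
    unfolding w_def using assms that by (intro hadamard_weight_integrable)
  have "(\<integral>t. w t * (g t * f t) \<partial>lborel) * (\<integral>t. w t * h t \<partial>lborel)
      \<le> (\<integral>t. w t * f t \<partial>lborel) * (\<integral>t. w t * (g t * h t) \<partial>lborel)"
    using chebyshev_integral_cross_mult[of lborel "\<lambda>t. w t * f t" "\<lambda>t. w t * h t" g] cross
      int[OF cont(1)] int[OF cont(3)] int[OF continuous_on_mult[OF cont(2,1)]]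
      int[OF continuous_on_mult[OF cont(2,3)]]
    by (simp add: mult.left_commute)
  moreover have "0 < (\<integral>t. w t * h t \<partial>lborel)"
    unfolding w_def using assms cont by (intro hadamard_weight_integral_pos) auto
  moreover have "0 < (\<integral>t. w t * (g t * h t) \<partial>lborel)"
    unfolding w_def using assms cont
    by (intro hadamard_weight_integral_pos continuous_on_mult) auto
  ultimately show ?thesis
    using \<open>c > 0\<close>
    unfolding prop_hadamard_eq_weighted_integral w_def[symmetric] c_def[symmetric]
    by (simp add: divide_le_eq field_simps)
qed

end
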